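(* Up to equivalence there are exactly three complete standard systems: $\mathbf{GS1p}$, $\mathbf{Pp}$ and $\mathbf{Np}$. That is, each of these three is a complete standard system, and every complete standard system is equivalent to one of them.
   Context: Formulas are built from literals (propositional variables $P$ and their complements $\bar P$) using $\wedge$ and $\vee$. Negation satisfies $\neg P=\bar P$ and is extended by De Morgan's laws. A sequent is a nonempty finite multiset of formulas. A comma denotes multiset union, and $\Gamma,\Delta,\Sigma$ denote possibly empty multisets. A formula is valid if it evaluates to $1$ under every $0/1$-assignment. Rules: - Axiom: infer $P,\neg P$ from no premises. - $(\&)$: from $\Gamma,A$ and $\Gamma,B$ infer $\Gamma,A\wedge B$. - $(\otimes)$: from $\Delta,A$ and $\Sigma,B$ infer $\Delta,\Sigma,A\wedge B$. - $(\oplus)$: consists of both $(\oplus_1)$ and $(\oplus_2)$, where $(\oplus_i)$ infers $\Gamma,A_1\vee A_2$ from $\Gamma,A_i$. - $(\mathrm{par})$: from $\Gamma,A,B$ infer $\Gamma,A\vee B$. - $(\mathsf W)$: from $\Gamma$ infer $\Gamma,A$. - $(\mathsf C)$: from $\Gamma,A,A$ infer $\Gamma,A$. A standard system is the axiom together with any subset of $\{(\&),(\otimes),(\oplus),(\mathrm{par}),(\mathsf W),(\mathsf C)\}$. The named systems are: - $\mathbf{GS1p}$ = axiom + $(\&),(\oplus),(\mathsf W),(\mathsf C)$; - $\mathbf{Pp}$ = axiom + $(\otimes),(\oplus),(\mathsf C)$; - $\mathbf{Np}$ = axiom + $(\&),(\mathrm{par}),(\mathsf W)$. A rule is derivable in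 $S$ if, for every instance of it, the conclusion is derivable in $S$ from its premises used as extra leaves. $S$ contains $T$ if every rule of $T$ is derivable in $S$. Two systems are equivalent if each contains the other. A system is complete if every valid formula is derivable in it. *)

theory Defs
  imports "HOL-Library.Multiset"
begin

datatype 'v form =
    Var 'v
  | NVar 'v
  | And "'v form" "'v form"
  | Or "'v form" "'v form"

primrec neg :: "'v form \<Rightarrow> 'v form" where
  "neg (Var p) = NVar p"
| "neg (NVar p) = Var p"
| "neg (And A B) = Or (neg A) (neg B)"
| "neg (Or A B) = And (neg A) (neg B)"

primrec eval :: "('v \<Rightarrow> bool) \<Rightarrow> 'v form \<Rightarrow> bool" where
  "eval v (Var p) \<longleftrightarrow> v p"
| "eval v (NVar p) \<longleftrightarrow> \<not> v p"
| "eval v (And A B) \<longleftrightarrow> eval v A \<and> eval v B"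
| "eval v (Or A B) \<longleftrightarrow> eval v A \<or> eval v B"

definition valid :: "'v form \<Rightarrow> bool" where
  "valid A \<longleftrightarrow> (\<forall>v. eval v A)"

text \<open>
  Sequents are nonempty multisets of formulas; a rule is the set of its instances, each a list of
  premises together with a conclusion.  Nonemptiness is not part of the type, but is guaranteed
  for all premises and conclusions of the rules below.  Only weakening needs an explicit side
  condition for this: its premise is a bare context, which as a sequent must be nonempty.
\<close>

type_synonym 'v sequent = "'v form multiset"
type_synonym 'v rule = "('v sequent list \<times> 'v sequent) set"
type_synonym 'v system = "'v rule set"

definition ax_rule :: "'v rule" where
  "ax_rule = {([], {#Var p, neg (Var p)#}) | p. True}"

definition with_rule :: "'v rule" where
  "with_rule = {([add_mset A \<Gamma>, add_mset B \<Gamma>], add_mset (And A B) \<Gamma>) | \<Gamma> A B. True}"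

definition tensor_rule :: "'v rule" where
  "tensor_rule =
    {([add_mset A \<Delta>, add_mset B \<Sigma>], add_mset (And A B) (\<Delta> + \<Sigma>)) | \<Delta> \<Sigma> A B. True}"

definition plus1_rule :: "'v rule" where
  "plus1_rule = {([add_mset A \<Gamma>], add_mset (Or A B) \<Gamma>) | \<Gamma> A B. True}"

definition plus2_rule :: "'v rule" where
  "plus2_rule = {([add_mset B \<Gamma>], add_mset (Or A B) \<Gamma>) | \<Gamma> A B. True}"

definition plus_rule :: "'v rule" where
  "plus_rule = plus1_rule \<union> plus2_rule"

definition par_rule :: "'v rule" where
  "par_rule = {([add_mset A (add_mset B \<Gamma>)], add_mset (Or A B) \<Gamma>) | \<Gamma> A B. True}"

definition weak_rule :: "'v rule" where
  "weak_rule = {([\<Gamma>], add_mset A \<Gamma>) | \<Gamma> A. \<Gamma> \<noteq> {#}}"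

definition contr_rule :: "'v rule" where
  "contr_rule = {([add_mset A (add_mset A \<Gamma>)], add_mset A \<Gamma>) | \<Gamma> A. True}"

definition standard_system :: "'v system \<Rightarrow> bool" where
  "standard_system S \<longleftrightarrow>
    (\<exists>R. R \<subseteq> {with_rule, tensor_rule, plus_rule, par_rule, weak_rule, contr_rule} \<and>
         S = insert ax_rule R)"

definition GS1p :: "'v system" where
  "GS1p = {ax_rule, with_rule, plus_rule, weak_rule, contr_rule}"

definition Pp :: "'v system" where
  "Pp = {ax_rule, tensor_rule, plus_rule, contr_rule}"

definition Np :: "'v system" where
  "Np = {ax_rule, with_rule, par_rule, weak_rule}"

text \<open>
  \<open>derives S H \<Gamma>\<close>: there is a derivation tree of \<open>\<Gamma>\<close> in \<open>S\<close> whose leaves may additionally be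
  sequents of \<open>H\<close>, each usable any number of times.
\<close>

inductive derives :: "'v system \<Rightarrow> 'v sequent set \<Rightarrow> 'v sequent \<Rightarrow> bool"
  for S :: "'v system" and H :: "'v sequent set" where
  leaf: "\<Gamma> \<in> H \<Longrightarrow> derives S H \<Gamma>"
| step: "\<lbrakk>r \<in> S; (Ps, \<Gamma>) \<in> r; \<And>\<Delta>. \<Delta> \<in> set Ps \<Longrightarrow> derives S H \<Delta>\<rbrakk> \<Longrightarrow> derives S H \<Gamma>"

definition derivable_rule :: "'v system \<Rightarrow> 'v rule \<Rightarrow> bool" where
  "derivable_rule S r \<longleftrightarrow> (\<forall>(Ps, \<Gamma>) \<in> r. derives S (set Ps) \<Gamma>)"

definition contains_system :: "'v system \<Rightarrow> 'v system \<Rightarrow> bool" where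
  "contains_system S T \<longleftrightarrow> (\<forall>r \<in> T. derivable_rule S r)"

definition equivalent_systems :: "'v system \<Rightarrow> 'v system \<Rightarrow> bool" where
  "equivalent_systems S T \<longleftrightarrow> contains_system S T \<and> contains_system T S"

definition complete_system :: "'v system \<Rightarrow> bool" where
  "complete_system S \<longleftrightarrow> (\<forall>A. valid A \<longrightarrow> derives S {} {#A#})"

end

theory Submission
  imports Defs
begin

text \<open>
  In the presence of weakening and contraction the two conjunction rules are interderivable, and so
  are the two disjunction rules; weakening alone makes \<open>&\<close> and par the stronger ones, contraction
  alone makes \<open>\<otimes>\<close> and \<open>\<oplus>\<close> the stronger ones.  Completeness of \<open>Np\<close> is the usual backward proof
  search, and \<open>GS1p\<close> contains \<open>Np\<close>.  For \<open>Pp\<close>, every \<open>Np\<close>-derivation of \<open>\<Gamma>\<close> is transformed into a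
  \<open>Pp\<close>-derivation of a sequent whose formulas all occur in \<open>\<Gamma>\<close>; if \<open>\<Gamma>\<close> is a single formula,
  contraction then yields \<open>\<Gamma>\<close> itself.

  Every other standard system misses a conjunction rule, a disjunction rule, or one of the pairs
  contraction/\<open>&\<close>, contraction/par, weakening/contraction, weakening/\<open>\<otimes>\<close>, weakening/\<open>\<oplus>\<close>.  In each of
  these cases some valid formula violates an invariant of the remaining rules.
\<close>

section \<open>Derivations\<close>

lemma derives_ax: "ax_rule \<in> S \<Longrightarrow> derives S H {#Var p, NVar p#}"
  by (rule derives.step[of ax_rule S "[]"]) (auto simp: ax_rule_def)

lemma derives_with:
  "\<lbrakk>with_rule \<in> S; derives S H (add_mset A \<Gamma>); derives S H (add_mset B \<Gamma>)\<rbrakk>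
    \<Longrightarrow> derives S H (add_mset (And A B) \<Gamma>)"
  by (rule derives.step[of with_rule S "[add_mset A \<Gamma>, add_mset B \<Gamma>]"]) (auto simp: with_rule_def)

lemma derives_tensor:
  "\<lbrakk>tensor_rule \<in> S; derives S H (add_mset A \<Delta>); derives S H (add_mset B \<Sigma>)\<rbrakk>
    \<Longrightarrow> derives S H (add_mset (And A B) (\<Delta> + \<Sigma>))"
  by (rule derives.step[of tensor_rule S "[add_mset A \<Delta>, add_mset B \<Sigma>]"])
     (auto simp: tensor_rule_def)

lemma derives_plus1:
  "\<lbrakk>plus_rule \<in> S; derives S H (add_mset A \<Gamma>)\<rbrakk> \<Longrightarrow> derives S H (add_mset (Or A B) \<Gamma>)"
  by (rule derives.step[of plus_rule S "[add_mset A \<Gamma>]"])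
     (auto simp: plus_rule_def plus1_rule_def)

lemma derives_plus2:
  "\<lbrakk>plus_rule \<in> S; derives S H (add_mset B \<Gamma>)\<rbrakk> \<Longrightarrow> derives S H (add_mset (Or A B) \<Gamma>)"
  by (rule derives.step[of plus_rule S "[add_mset B \<Gamma>]"])
     (auto simp: plus_rule_def plus2_rule_def)

lemma derives_par:
  "\<lbrakk>par_rule \<in> S; derives S H (add_mset A (add_mset B \<Gamma>))\<rbrakk> \<Longrightarrow> derives S H (add_mset (Or A B) \<Gamma>)"
  by (rule derives.step[of par_rule S "[add_mset A (add_mset B \<Gamma>)]"]) (auto simp: par_rule_def)

lemma derives_weak:
  assumes "weak_rule \<in> S" "\<Gamma> \<noteq> {#}" "derives S H \<Gamma>"
  shows "derives S H (\<Gamma> + \<Delta>)"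
proof (induction \<Delta>)
  case empty
  then show ?case using assms(3) by simp
next
  case (add A \<Delta>)
  have "([\<Gamma> + \<Delta>], \<Gamma> + add_mset A \<Delta>) \<in> weak_rule"
    using assms(2) by (auto simp: weak_rule_def)
  then show ?case using assms(1) add by (auto intro: derives.step)
qed

text \<open>Every formula of \<open>\<Delta>\<close> has a copy in \<open>\<Gamma>\<close>, so
  \<open>\<Delta>\<close> is absorbed one formula at a time.\<close>

lemma derives_contr:
  assumes "contr_rule \<in> S" "set_mset \<Delta> \<subseteq> set_mset \<Gamma>" "derives S H (\<Gamma> + \<Delta>)"
  shows "derives S H \<Gamma>"
  using assms(2,3)
proof (induction \<Delta>)
  case empty
  then show ?case by simp
next
  case (add A \<Delta>)
  then obtain \<Gamma>' where \<Gamma>: "\<Gamma> = add_mset A \<Gamma>'"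
    by (auto dest: multi_member_split)
  have "\<exists>\<Gamma>'' B. \<Gamma> + add_mset A \<Delta> = add_mset B (add_mset B \<Gamma>'') \<and> \<Gamma> + \<Delta> = add_mset B \<Gamma>''"
    by (intro exI[of _ "\<Gamma>' + \<Delta>"] exI[of _ A]) (simp add: \<Gamma>)
  then have "([\<Gamma> + add_mset A \<Delta>], \<Gamma> + \<Delta>) \<in> contr_rule"
    by (auto simp: contr_rule_def)
  then have "derives S H (\<Gamma> + \<Delta>)"
    using add.prems(2) assms(1) by (auto intro: derives.step)
  then show ?case using add by simp
qed

lemma derives_contr_set:
  assumes "contr_rule \<in> S" "derives S H \<Gamma>"
  shows "derives S H (mset_set (set_mset \<Gamma>))"
proof (rule derives_contr[OF assms(1)])
  show "set_mset (\<Gamma> - mset_set (set_mset \<Gamma>)) \<subseteq> set_mset (mset_set (set_mset \<Gamma>))"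
    by (auto dest: in_diffD)
  show "derives S H (mset_set (set_mset \<Gamma>) + (\<Gamma> - mset_set (set_mset \<Gamma>)))"
    using assms(2) by (simp add: mset_set_set_mset_msubset)
qed

lemma derives_subst:
  assumes "derives S K \<Gamma>" "\<And>\<Delta>. \<Delta> \<in> K \<Longrightarrow> derives S H \<Delta>"
  shows "derives S H \<Gamma>"
  using assms by (induction) (auto intro: derives.step)

lemma derives_contains:
  assumes "contains_system S T" "derives T H \<Gamma>"
  shows "derives S H \<Gamma>"
  using assms(2)
proof induction
  case (leaf \<Gamma>)
  then show ?case by (rule derives.leaf)
next
  case (step r Ps \<Gamma>)
  then have "derives S (set Ps) \<Gamma>"
    using assms(1) by (auto simp: contains_system_def derivable_rule_def)
  then show ?case using step by (blast intro: derives_subst)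
qed

lemma derivable_rule_member: "r \<in> S \<Longrightarrow> derivable_rule S r"
  unfolding derivable_rule_def by (blast intro: derives.step derives.leaf)

section \<open>Interderivability of the rules\<close>

text \<open>Weaken each premise by the context of the other, then apply
  \<open>with_rule\<close>.\<close>

lemma derivable_tensor:
  assumes "with_rule \<in> S" "weak_rule \<in> S"
  shows "derivable_rule S tensor_rule"
proof -
  have "derives S H (add_mset (And A B) (\<Delta> + \<Sigma>))"
    if "derives S H (add_mset A \<Delta>)" "derives S H (add_mset B \<Sigma>)" for H A B \<Delta> \<Sigma>
    using derives_weak[OF assms(2) _ that(1), of \<Sigma>] derives_weak[OF assms(2) _ that(2), of \<Delta>]
    by (auto intro!: derives_with[OF assms(1)] simp: ac_simps)
  then show ?thesis
    by (auto simp: derivable_rule_def tensor_rule_def derives.leaf)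
qed

text \<open>The tensor rule yields the context twice; contraction merges the copies.\<close>

lemma derivable_with:
  assumes "tensor_rule \<in> S" "contr_rule \<in> S"
  shows "derivable_rule S with_rule"
proof -
  have "derives S H (add_mset (And A B) \<Gamma>)"
    if "derives S H (add_mset A \<Gamma>)" "derives S H (add_mset B \<Gamma>)" for H A B \<Gamma>
    using derives_tensor[OF assms(1) that] derives_contr[OF assms(2), of \<Gamma> "add_mset (And A B) \<Gamma>"]
    by simp blast
  then show ?thesis
    by (auto simp: derivable_rule_def with_rule_def derives.leaf)
qed

lemma derivable_plus:
  assumes "par_rule \<in> S" "weak_rule \<in> S"
  shows "derivable_rule S plus_rule"
proof -
  have "derives S H (add_mset (Or A B) \<Gamma>)"
    if "derives S H (add_mset A \<Gamma>) \<or> derives S H (add_mset B \<Gamma>)" for H A B \<Gamma>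
    using that derives_weak[OF assms(2), of "add_mset A \<Gamma>" H "{#B#}"]
      derives_weak[OF assms(2), of "add_mset B \<Gamma>" H "{#A#}"]
    by (auto intro!: derives_par[OF assms(1)] simp: add_mset_commute)
  then show ?thesis
    by (auto simp: derivable_rule_def plus_rule_def plus1_rule_def plus2_rule_def derives.leaf)
qed

text \<open>Inject the disjuncts one after the other, then contract the two copies of
  \<open>Or A B\<close>.\<close>

lemma derivable_par:
  assumes "plus_rule \<in> S" "contr_rule \<in> S"
  shows "derivable_rule S par_rule"
proof -
  have "derives S H (add_mset (Or A B) \<Gamma>)"
    if "derives S H (add_mset A (add_mset B \<Gamma>))" for H A B \<Gamma>
  proof -
    have "derives S H (add_mset B (add_mset (Or A B) \<Gamma>))"
      using derives_plus1[OF assms(1) that, of B] by (simp add: add_mset_commute)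
    then have "derives S H (add_mset (Or A B) (add_mset (Or A B) \<Gamma>))"
      by (rule derives_plus2[OF assms(1)])
    then show ?thesis
      using derives_contr[OF assms(2), of "{#Or A B#}" "add_mset (Or A B) \<Gamma>"] by simp
  qed
  then show ?thesis
    by (auto simp: derivable_rule_def par_rule_def derives.leaf)
qed

section \<open>Completeness\<close>

definition valid_sequent :: "'v sequent \<Rightarrow> bool" where
  "valid_sequent \<Gamma> \<longleftrightarrow> (\<forall>v. \<exists>A \<in># \<Gamma>. eval v A)"

lemma valid_sequent_single: "valid_sequent {#A#} \<longleftrightarrow> valid A"
  by (simp add: valid_sequent_def valid_def)

text \<open>Both logical rules are invertible: premises of a valid conclusion are valid, and of
  smaller total size. A valid sequent of literals is a weakened axiom.\<close>

lemma Np_derives_valid_sequent: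
  "valid_sequent \<Gamma> \<Longrightarrow> derives Np {} \<Gamma>"
proof (induction "\<Sum>A\<in>#\<Gamma>. size A" arbitrary: \<Gamma> rule: less_induct)
  case less
  consider (And) A B where "And A B \<in># \<Gamma>" | (Or) A B where "Or A B \<in># \<Gamma>"
    | (lit) "\<And>A B. And A B \<notin># \<Gamma>" "\<And>A B. Or A B \<notin># \<Gamma>"
    by blast
  then show ?case
  proof cases
    case And
    then obtain \<Gamma>' where \<Gamma>: "\<Gamma> = add_mset (And A B) \<Gamma>'"
      by (auto dest: multi_member_split)
    have "valid_sequent (add_mset A \<Gamma>')" "valid_sequent (add_mset B \<Gamma>')"
      using less.prems by (auto simp: valid_sequent_def \<Gamma>)
    then have "derives Np {} (add_mset A \<Gamma>')" "derives Np {} (add_mset B \<Gamma>')"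
      by (auto intro!: less.hyps simp: \<Gamma>)
    then show ?thesis unfolding \<Gamma> by (intro derives_with) (auto simp: Np_def)
  next
    case Or
    then obtain \<Gamma>' where \<Gamma>: "\<Gamma> = add_mset (Or A B) \<Gamma>'"
      by (auto dest: multi_member_split)
    have "valid_sequent (add_mset A (add_mset B \<Gamma>'))"
      using less.prems by (auto simp: valid_sequent_def \<Gamma>)
    then have "derives Np {} (add_mset A (add_mset B \<Gamma>'))"
      by (auto intro!: less.hyps simp: \<Gamma>)
    then show ?thesis unfolding \<Gamma> by (intro derives_par) (auto simp: Np_def)
  next
    case lit
    \<comment> \<open>This assignment falsifies every \<open>NVar p\<close> in
      \<open>\<Gamma>\<close>, so the true literal is some \<open>Var p\<close>, and its truth means
      that \<open>NVar p\<close> is in \<open>\<Gamma>\<close>.\<close>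
    obtain A where A: "A \<in># \<Gamma>" "eval (\<lambda>p. NVar p \<in># \<Gamma>) A"
      using less.prems by (auto simp: valid_sequent_def)
    then obtain p where p: "Var p \<in># \<Gamma>" "NVar p \<in># \<Gamma>"
      using lit by (cases A) auto
    then have "{#Var p, NVar p#} \<subseteq># \<Gamma>"
      by (simp add: insert_subset_eq_iff in_diff_count)
    then obtain \<Delta> where \<Gamma>: "\<Gamma> = {#Var p, NVar p#} + \<Delta>"
      by (auto simp: mset_subset_eq_exists_conv)
    show ?thesis unfolding \<Gamma>
      by (intro derives_weak derives_ax) (auto simp: Np_def)
  qed
qed

lemma complete_Np: "complete_system Np"
  by (simp add: complete_system_def Np_derives_valid_sequent valid_sequent_single)

lemma GS1p_contains_Np: "contains_system GS1p Np"
  by (simp add: contains_system_def Np_def GS1p_def derivable_rule_member derivable_par)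

lemma complete_GS1p: "complete_system GS1p"
  by (auto simp: complete_system_def valid_sequent_single
      intro!: derives_contains[OF GS1p_contains_Np] Np_derives_valid_sequent)

section \<open>Completeness of \<open>Pp\<close>\<close>

text \<open>Contracting first to a single copy of \<open>A\<close> ensures that none is left once it
  is replaced by \<open>C\<close>.\<close>

lemma Pp_derives_plus:
  assumes "derives Pp H \<Gamma>" "A \<in># \<Gamma>" "C = Or A B \<or> C = Or B A"
  shows "\<exists>\<Gamma>'. derives Pp H \<Gamma>' \<and> set_mset \<Gamma>' = insert C (set_mset \<Gamma> - {A})"
proof -
  have "derives Pp H (add_mset A (mset_set (set_mset \<Gamma> - {A})))"
    using derives_contr_set[OF _ assms(1)] assms(2)
    by (simp add: Pp_def mset_set.remove)
  then have "derives Pp H (add_mset C (mset_set (set_mset \<Gamma> - {A})))"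
    using assms(3) by (auto simp: Pp_def intro: derives_plus1 derives_plus2)
  then show ?thesis by (intro exI conjI, assumption) auto
qed

lemma Pp_derives_tensor:
  assumes "derives Pp H \<Gamma>" "A \<in># \<Gamma>" "derives Pp H \<Delta>" "B \<in># \<Delta>"
  shows "\<exists>\<Sigma>. derives Pp H \<Sigma> \<and>
    set_mset \<Sigma> = insert (And A B) ((set_mset \<Gamma> - {A}) \<union> (set_mset \<Delta> - {B}))"
proof -
  have "derives Pp H (add_mset A (mset_set (set_mset \<Gamma> - {A})))"
    "derives Pp H (add_mset B (mset_set (set_mset \<Delta> - {B})))"
    using derives_contr_set[OF _ assms(1)] derives_contr_set[OF _ assms(3)] assms(2,4)
    by (simp_all add: Pp_def mset_set.remove)
  then have "derives Pp H
      (add_mset (And A B) (mset_set (set_mset \<Gamma> - {A}) + mset_set (set_mset \<Delta> - {B})))"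
    by (intro derives_tensor) (auto simp: Pp_def)
  then show ?thesis by (intro exI conjI, assumption) auto
qed

text \<open>If the sequent found for a premise lacks the active formulas, it already serves for the
  conclusion; otherwise the matching rules of \<open>Pp\<close> apply up to contraction. Weakening
  is absorbed by the inclusion.\<close>

lemma Np_to_Pp:
  "derives Np {} \<Gamma> \<Longrightarrow> \<exists>\<Delta>. derives Pp {} \<Delta> \<and> set_mset \<Delta> \<subseteq> set_mset \<Gamma>"
proof (induction rule: derives.induct)
  case (leaf \<Gamma>)
  then show ?case by simp
next
  case (step r Ps \<Gamma>)
  consider "r = ax_rule" | "r = with_rule" | "r = par_rule" | "r = weak_rule"
    using step.hyps(1) by (auto simp: Np_def)
  then show ?case
  proof cases
    case 1
    then obtain p where "\<Gamma> = {#Var p, NVar p#}"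
      using step.hyps(2) by (auto simp: ax_rule_def)
    moreover have "derives Pp {} {#Var p, NVar p#}"
      by (rule derives_ax) (simp add: Pp_def)
    ultimately show ?thesis by blast
  next
    case 2
    then obtain A B \<Gamma>' where \<Gamma>: "\<Gamma> = add_mset (And A B) \<Gamma>'"
      and Ps: "Ps = [add_mset A \<Gamma>', add_mset B \<Gamma>']"
      using step.hyps(2) by (auto simp: with_rule_def)
    obtain \<Delta> where \<Delta>: "derives Pp {} \<Delta>" "set_mset \<Delta> \<subseteq> insert A (set_mset \<Gamma>')"
      using step.IH[of "add_mset A \<Gamma>'"] by (auto simp: Ps)
    obtain \<Sigma> where \<Sigma>: "derives Pp {} \<Sigma>" "set_mset \<Sigma> \<subseteq> insert B (set_mset \<Gamma>')"
      using step.IH[of "add_mset B \<Gamma>'"] by (auto simp: Ps)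
    consider "A \<notin># \<Delta>" | "B \<notin># \<Sigma>" | "A \<in># \<Delta>" "B \<in># \<Sigma>" by blast
    then show ?thesis
    proof cases
      case 1
      then show ?thesis using \<Delta> by (auto simp: \<Gamma>)
    next
      case 2
      then show ?thesis using \<Sigma> by (auto simp: \<Gamma>)
    next
      case 3
      obtain \<Theta> where "derives Pp {} \<Theta>"
        "set_mset \<Theta> = insert (And A B) ((set_mset \<Delta> - {A}) \<union> (set_mset \<Sigma> - {B}))"
        using Pp_derives_tensor[OF \<Delta>(1) 3(1) \<Sigma>(1) 3(2)] by blast
      then show ?thesis using \<Delta>(2) \<Sigma>(2) by (intro exI[of _ \<Theta>]) (auto simp: \<Gamma>)
    qed
  next
    case 3
    then obtain A B \<Gamma>' where \<Gamma>: "\<Gamma> = add_mset (Or A B) \<Gamma>'"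
      and Ps: "Ps = [add_mset A (add_mset B \<Gamma>')]"
      using step.hyps(2) by (auto simp: par_rule_def)
    obtain \<Delta> where \<Delta>: "derives Pp {} \<Delta>" "set_mset \<Delta> \<subseteq> insert A (insert B (set_mset \<Gamma>'))"
      using step.IH[of "add_mset A (add_mset B \<Gamma>')"] by (auto simp: Ps)
    \<comment> \<open>Once \<open>A\<close> is injected, only \<open>B\<close> can still lie outside
      \<open>\<Gamma>\<close>.\<close>
    obtain \<Delta>' where \<Delta>': "derives Pp {} \<Delta>'" "set_mset \<Delta>' \<subseteq> insert B (set_mset \<Gamma>)"
    proof (cases "A \<in># \<Delta>")
      case True
      obtain \<Delta>'' where "derives Pp {} \<Delta>''" "set_mset \<Delta>'' = insert (Or A B) (set_mset \<Delta> - {A})"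
        using Pp_derives_plus[OF \<Delta>(1) True, of "Or A B" B] by blast
      then show ?thesis using \<Delta>(2) by (intro that[of \<Delta>'']) (auto simp: \<Gamma>)
    next
      case False
      then show ?thesis using \<Delta> by (intro that[of \<Delta>]) (auto simp: \<Gamma>)
    qed
    show ?thesis
    proof (cases "B \<in># \<Delta>'")
      case True
      obtain \<Theta> where "derives Pp {} \<Theta>" "set_mset \<Theta> = insert (Or A B) (set_mset \<Delta>' - {B})"
        using Pp_derives_plus[OF \<Delta>'(1) True, of "Or A B" A] by blast
      then show ?thesis using \<Delta>'(2) by (intro exI[of _ \<Theta>]) (auto simp: \<Gamma>)
    next
      case False
      then show ?thesis using \<Delta>' by (auto simp: \<Gamma>)
    qed
  next
    case 4
    then show ?thesis using step.hyps(2) step.IH by (fastforce simp: weak_rule_def)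
  qed
qed

text \<open>Rules out the empty sequent, which the inclusion in \<open>Np_to_Pp\<close> would
  admit.\<close>

lemma Pp_derives_nonempty: "derives Pp {} \<Gamma> \<Longrightarrow> \<Gamma> \<noteq> {#}"
  by (induction rule: derives.induct)
     (auto simp: Pp_def ax_rule_def tensor_rule_def plus_rule_def plus1_rule_def plus2_rule_def
       contr_rule_def)

lemma complete_Pp: "complete_system Pp"
  unfolding complete_system_def
proof (intro allI impI)
  fix A :: "'a form"
  assume "valid A"
  then have "derives Np {} {#A#}"
    by (simp add: Np_derives_valid_sequent valid_sequent_single)
  then obtain \<Delta> where \<Delta>: "derives Pp {} \<Delta>" "set_mset \<Delta> \<subseteq> {A}"
    using Np_to_Pp by fastforce
  then have "set_mset \<Delta> = {A}"
    using Pp_derives_nonempty by fastforce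
  then show "derives Pp {} {#A#}"
    using derives_contr_set[OF _ \<Delta>(1)] by (simp add: Pp_def)
qed

section \<open>Invariants\<close>

definition preserves :: "('v sequent \<Rightarrow> bool) \<Rightarrow> 'v rule \<Rightarrow> bool" where
  "preserves I r \<longleftrightarrow> (\<forall>(Ps, \<Gamma>) \<in> r. (\<forall>\<Delta> \<in> set Ps. I \<Delta>) \<longrightarrow> I \<Gamma>)"

lemma derives_invariant:
  assumes "derives S H \<Gamma>" "\<And>r. r \<in> S \<Longrightarrow> preserves I r" "\<And>\<Delta>. \<Delta> \<in> H \<Longrightarrow> I \<Delta>"
  shows "I \<Gamma>"
  using assms by induction (fastforce simp: preserves_def)+

lemma incompleteI:
  assumes "valid A" "\<not> I {#A#}" "\<And>r. r \<in> S \<Longrightarrow> preserves I r"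
  shows "\<not> complete_system S"
  using derives_invariant[of S "{}" "{#A#}" I] assms by (auto simp: complete_system_def)

lemma preserves_ax: "preserves I ax_rule \<longleftrightarrow> (\<forall>p. I {#Var p, NVar p#})"
  by (auto simp: preserves_def ax_rule_def)

lemma preserves_instances2:
  "preserves I {(f x y, g x y) | x y. P x y} \<longleftrightarrow>
    (\<forall>x y. P x y \<longrightarrow> (\<forall>\<Delta> \<in> set (f x y). I \<Delta>) \<longrightarrow> I (g x y))"
  unfolding preserves_def by blast

lemma preserves_instances3:
  "preserves I {(f x y z, g x y z) | x y z. P x y z} \<longleftrightarrow>
    (\<forall>x y z. P x y z \<longrightarrow> (\<forall>\<Delta> \<in> set (f x y z). I \<Delta>) \<longrightarrow> I (g x y z))"
  unfolding preserves_def by blast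

lemma preserves_instances4:
  "preserves I {(f x y z w, g x y z w) | x y z w. P x y z w} \<longleftrightarrow>
    (\<forall>x y z w. P x y z w \<longrightarrow> (\<forall>\<Delta> \<in> set (f x y z w). I \<Delta>) \<longrightarrow> I (g x y z w))"
  unfolding preserves_def by blast

lemma preserves_Un: "preserves I (r \<union> s) \<longleftrightarrow> preserves I r \<and> preserves I s"
  unfolding preserves_def by blast

lemmas preserves_instances = preserves_instances2 preserves_instances3 preserves_instances4

lemma preserves_with: "preserves I with_rule \<longleftrightarrow>
    (\<forall>\<Gamma> A B. I (add_mset A \<Gamma>) \<and> I (add_mset B \<Gamma>) \<longrightarrow> I (add_mset (And A B) \<Gamma>))"
  unfolding with_rule_def preserves_instances by simp

lemma preserves_tensor: "preserves I tensor_rule \<longleftrightarrow>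
    (\<forall>\<Delta> \<Sigma> A B. I (add_mset A \<Delta>) \<and> I (add_mset B \<Sigma>) \<longrightarrow> I (add_mset (And A B) (\<Delta> + \<Sigma>)))"
  unfolding tensor_rule_def preserves_instances by simp

lemma preserves_plus: "preserves I plus_rule \<longleftrightarrow>
    (\<forall>\<Gamma> A B. I (add_mset A \<Gamma>) \<or> I (add_mset B \<Gamma>) \<longrightarrow> I (add_mset (Or A B) \<Gamma>))"
  unfolding plus_rule_def plus1_rule_def plus2_rule_def preserves_Un preserves_instances by auto

lemma preserves_par: "preserves I par_rule \<longleftrightarrow>
    (\<forall>\<Gamma> A B. I (add_mset A (add_mset B \<Gamma>)) \<longrightarrow> I (add_mset (Or A B) \<Gamma>))"
  unfolding par_rule_def preserves_instances by simp

lemma preserves_weak: "preserves I weak_rule \<longleftrightarrow>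
    (\<forall>\<Gamma> A. \<Gamma> \<noteq> {#} \<longrightarrow> I \<Gamma> \<longrightarrow> I (add_mset A \<Gamma>))"
  unfolding weak_rule_def preserves_instances by simp

lemma preserves_contr: "preserves I contr_rule \<longleftrightarrow>
    (\<forall>\<Gamma> A. I (add_mset A (add_mset A \<Gamma>)) \<longrightarrow> I (add_mset A \<Gamma>))"
  unfolding contr_rule_def preserves_instances by simp
lemmas preserves_simps = preserves_ax preserves_with preserves_tensor preserves_plus preserves_par
  preserves_weak preserves_contr

section \<open>Incomplete sets of rules\<close>

text \<open>Only weakening and contraction can conclude a sequent made of copies of one conjunction,
  and their premise is then of the same kind.\<close>

lemma incomplete_without_conj:
  assumes "S \<subseteq> {ax_rule, plus_rule, par_rule, weak_rule, contr_rule}"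
  shows "\<not> complete_system S"
proof -
  let ?T = "\<lambda>p. Or (Var p) (NVar p)"
  let ?A = "And (?T undefined) (?T undefined)"
  let ?I = "\<lambda>\<Gamma>. \<not> set_mset \<Gamma> \<subseteq> {?A}"
  have "preserves ?I ax_rule" "preserves ?I plus_rule" "preserves ?I par_rule"
    "preserves ?I weak_rule" "preserves ?I contr_rule"
    by (auto simp: preserves_simps)
  then show ?thesis
    using assms by (intro incompleteI[of ?A ?I]) (auto simp: valid_def)
qed

lemma incomplete_without_disj:
  assumes "S \<subseteq> {ax_rule, with_rule, tensor_rule, weak_rule, contr_rule}"
  shows "\<not> complete_system S"
proof -
  let ?A = "Or (Var undefined) (NVar undefined)"
  let ?I = "\<lambda>\<Gamma>. \<not> set_mset \<Gamma> \<subseteq> {?A}"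
  have "preserves ?I ax_rule" "preserves ?I with_rule" "preserves ?I tensor_rule"
    "preserves ?I weak_rule" "preserves ?I contr_rule"
    by (auto simp: preserves_simps)
  then show ?thesis
    using assms by (intro incompleteI[of ?A ?I]) (auto simp: valid_def)
qed

text \<open>The axiom has two formulas, and no other rule here leads from sequents with at least two
  formulas to a single one.\<close>

lemma incomplete_without_par_contr:
  assumes "S \<subseteq> {ax_rule, with_rule, tensor_rule, plus_rule, weak_rule}"
  shows "\<not> complete_system S"
proof -
  let ?A = "Or (Var undefined) (NVar undefined)"
  let ?I = "\<lambda>\<Gamma>. size \<Gamma> \<ge> 2"
  have "preserves ?I ax_rule" "preserves ?I with_rule" "preserves ?I tensor_rule"
    "preserves ?I plus_rule" "preserves ?I weak_rule"
    by (auto simp: preserves_simps)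
  then show ?thesis
    using assms by (intro incompleteI[of ?A ?I]) (auto simp: valid_def)
qed

text \<open>
  Lukasiewicz's three-valued logic with values 0, 1/2, 1 scaled by 2 and every literal evaluated to
  1/2; the truncated subtraction is intended.
\<close>
primrec luk :: "'v form \<Rightarrow> nat" where
  "luk (Var p) = 1"
| "luk (NVar p) = 1"
| "luk (And A B) = luk A + luk B - 2"
| "luk (Or A B) = min 2 (luk A + luk B)"

text \<open>A sequent is read as a strong disjunction: it holds if its values sum to at least 2. The
  tensor rule is sound for the strong conjunction.\<close>

lemma incomplete_without_with_contr:
  assumes "S \<subseteq> {ax_rule, tensor_rule, plus_rule, par_rule, weak_rule}"
  shows "\<not> complete_system S"
proof -
  let ?p = "Var undefined"
  \<comment> \<open>The conjunction of \<open>?p\<close> with itself has value 0, so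
    \<open>?A\<close> has value 1, below the threshold.\<close>
  let ?A = "Or (And ?p ?p) (neg ?p)"
  let ?I = "\<lambda>\<Gamma>. (\<Sum>A\<in>#\<Gamma>. luk A) \<ge> 2"
  have "preserves ?I ax_rule" "preserves ?I tensor_rule"
    "preserves ?I plus_rule" "preserves ?I par_rule" "preserves ?I weak_rule"
    by (auto simp: preserves_simps min_def)
  then show ?thesis
    using assms by (intro incompleteI[of ?A ?I]) (auto simp: valid_def)
qed

text \<open>
  The three-element Sugihara matrix, which refutes irrelevant disjuncts: \<open>q\<close> is false, and all
  variables other than \<open>q\<close> get the self-dual value 0.
\<close>
primrec sug :: "'v \<Rightarrow> 'v form \<Rightarrow> int" where
  "sug q (Var p) = (if p = q then -1 else 0)"
| "sug q (NVar p) = (if p = q then 1 else 0)"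
| "sug q (And A B) =
    (if sug q A = -1 \<or> sug q B = -1 then -1 else max (sug q A) (sug q B))"
| "sug q (Or A B) =
    (if sug q A = 1 \<or> sug q B = 1 then 1 else min (sug q A) (sug q B))"

text \<open>The invariant says that the \<open>Or\<close> of all formulas of the sequent has a
  nonnegative, that is designated, value.\<close>

lemma incomplete_without_plus_weak:
  fixes p q :: 'v and S :: "'v system"
  assumes "p \<noteq> q" and "S \<subseteq> {ax_rule, with_rule, tensor_rule, par_rule, contr_rule}"
  shows "\<not> complete_system S"
proof -
  \<comment> \<open>The excluded middle for \<open>p\<close> has value 0, and the disjunct
    \<open>Var q\<close> lowers it to -1.\<close>
  let ?A = "Or (Or (Var p) (NVar p)) (Var q)"
  let ?I = "\<lambda>\<Gamma>. (\<exists>A \<in># \<Gamma>. sug q A = 1) \<or> (\<forall>A \<in># \<Gamma>. sug q A = 0)"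
  have "preserves ?I ax_rule" "preserves ?I with_rule" "preserves ?I tensor_rule"
    "preserves ?I par_rule" "preserves ?I contr_rule"
    unfolding preserves_simps by (simp, auto)
  then show ?thesis
    using assms by (intro incompleteI[of ?A ?I]) (auto simp: valid_def)
qed

text \<open>
  The separating formula for the two remaining cases, in which weakening is absent:
  \<open>((P \<and> Q) \<or> (\<not>Q \<and> P)) \<or> \<not>P\<close>.
\<close>
definition sep_form :: "'v \<Rightarrow> 'v \<Rightarrow> 'v form" where
  "sep_form p q = Or (Or (And (Var p) (Var q)) (And (NVar q) (Var p))) (NVar p)"

lemma valid_sep_form: "valid (sep_form p q)"
  by (auto simp: valid_def sep_form_def)

text \<open>
  With shared contexts only, refute backwards: take the \<open>Q\<close>-premise if \<open>P \<and> Q\<close> is decomposed first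
  and always the \<open>P\<close>-premise of \<open>\<not>Q \<and> P\<close> afterwards, so that \<open>Q\<close> never meets its complement;
  dually if \<open>\<not>Q \<and> P\<close> is decomposed first.
\<close>
lemma incomplete_without_tensor_weak:
  fixes p q :: 'v and S :: "'v system"
  assumes "p \<noteq> q" and "S \<subseteq> {ax_rule, with_rule, plus_rule, par_rule, contr_rule}"
  shows "\<not> complete_system S"
proof -
  let ?a = "And (Var p) (Var q)" and ?b = "And (NVar q) (Var p)"
  define X where "X = {sep_form p q, Or ?a ?b, ?a, ?b, NVar p}"
  \<comment> \<open>\<open>I\<close> is the complement of the refutable sequents. The presence of
    \<open>L\<close> keeps the axiom on \<open>p\<close> out of these, and the choice of only one
    \<open>L\<close> the axiom on \<open>q\<close>.\<close>
  define I where "I \<Gamma> \<longleftrightarrow> \<not> (set_mset \<Gamma> \<subseteq> X \<or>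
    (\<exists>L \<in> {Var q, NVar q}. L \<in># \<Gamma> \<and> set_mset \<Gamma> \<subseteq> X \<union> {Var p, L}))" for \<Gamma>
  have And_in_X: "A = Var p \<and> B = Var q \<or> A = NVar q \<and> B = Var p" if "And A B \<in> X" for A B
    using that by (auto simp: X_def sep_form_def)
  have Or_in_X: "A \<in> X \<and> B \<in> X" if "Or A B \<in> X" for A B
    using that by (auto simp: X_def sep_form_def)
  have "I {#Var r, NVar r#}" for r
    using assms(1) by (auto simp: I_def X_def sep_form_def)
  then have "preserves I ax_rule"
    unfolding preserves_ax by blast
  moreover have "\<not> I (add_mset A \<Gamma>) \<or> \<not> I (add_mset B \<Gamma>)"
    if "\<not> I (add_mset (And A B) \<Gamma>)" for A B \<Gamma>
  proof -
    from that have "And A B \<in> X"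
      by (auto simp: I_def)
    then have AB: "A = Var p \<and> B = Var q \<or> A = NVar q \<and> B = Var p"
      by (rule And_in_X)
    from that consider L where "L \<in> {Var q, NVar q}" "L \<in># \<Gamma>" "set_mset \<Gamma> \<subseteq> X \<union> {Var p, L}"
      | "set_mset \<Gamma> \<subseteq> X"
      by (auto simp: I_def)
    then show ?thesis
    proof cases
      case 1
      then have "\<not> I (add_mset (Var p) \<Gamma>)"
        by (auto simp: I_def)
      then show ?thesis using AB by blast
    next
      case 2
      then have "\<not> I (add_mset (Var q) \<Gamma>)" "\<not> I (add_mset (NVar q) \<Gamma>)"
        by (auto simp: I_def)
      then show ?thesis using AB by blast
    qed
  qed
  then have "preserves I with_rule"
    unfolding preserves_with by blast
  moreover have "\<not> I (add_mset A \<Gamma>) \<and> \<not> I (add_mset B \<Gamma>) \<and> \<not> I (add_mset A (add_mset B \<Gamma>))"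
    if "\<not> I (add_mset (Or A B) \<Gamma>)" for A B \<Gamma>
  proof -
    from that have "Or A B \<in> X"
      by (auto simp: I_def)
    with Or_in_X have "A \<in> X" "B \<in> X" by blast+
    with that show ?thesis
      unfolding I_def by auto
  qed
  then have "preserves I plus_rule" "preserves I par_rule"
    unfolding preserves_plus preserves_par by blast+
  moreover have "preserves I contr_rule"
    unfolding preserves_contr I_def by simp
  moreover have "\<not> I {#sep_form p q#}"
    by (simp add: I_def X_def)
  ultimately show ?thesis
    using assms(2) by (intro incompleteI[of "sep_form p q" I] valid_sep_form) auto
qed

text \<open>Used to find the possible principal formulas of explicitly listed sequents.\<close>

lemma add_mset_eq_two: "add_mset x M = {#a, b#} \<longleftrightarrow> x = a \<and> M = {#b#} \<or> x = b \<and> M = {#a#}"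
  by (auto simp: add_eq_conv_ex)

lemma add_mset_eq_three: "add_mset x M = {#a, b, c#} \<longleftrightarrow>
    x = a \<and> M = {#b, c#} \<or> x = b \<and> M = {#a, c#} \<or> x = c \<and> M = {#a, b#}"
  by (auto simp: add_eq_conv_ex)

text \<open>
  Here the listed sequents are the valid ones met in a backward search from \<open>sep_form p q\<close>.  The
  tensor rule cannot produce them from valid premises, since each premise would need its own copy
  of \<open>NVar p\<close>, the only formula in the context that is true when \<open>p\<close> is false.
\<close>
lemma incomplete_without_weak_contr:
  fixes p q :: 'v and S :: "'v system"
  assumes "p \<noteq> q" and "S \<subseteq> {ax_rule, with_rule, tensor_rule, plus_rule, par_rule}"
  shows "\<not> complete_system S"
proof -
  let ?a = "And (Var p) (Var q)" and ?b = "And (NVar q) (Var p)" and ?c = "NVar p"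
  let ?L = "{{#sep_form p q#}, {#Or ?a ?b, ?c#}, {#?a, ?b, ?c#}, {#Var p, ?b, ?c#},
    {#?a, Var p, ?c#}, {#Var p, Var q, ?c#}, {#Var p, NVar q, ?c#}}"
  \<comment> \<open>Validity is included so that invalid premises can be discarded for the tensor
    and plus rules.\<close>
  let ?I = "\<lambda>\<Gamma>. valid_sequent \<Gamma> \<and> \<Gamma> \<notin> ?L"
  have And_in_L: "A = Var p \<and> B = Var q \<and> \<Gamma> \<in> {{#?b, ?c#}, {#Var p, ?c#}} \<or>
      A = NVar q \<and> B = Var p \<and> \<Gamma> \<in> {{#?a, ?c#}, {#Var p, ?c#}}"
    if "add_mset (And A B) \<Gamma> \<in> ?L" for A B \<Gamma>
    using that by (elim insertE emptyE) (auto simp: sep_form_def add_mset_eq_two add_mset_eq_three)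
  have Or_in_L: "A = Or ?a ?b \<and> B = ?c \<and> \<Gamma> = {#} \<or> A = ?a \<and> B = ?b \<and> \<Gamma> = {#?c#}"
    if "add_mset (Or A B) \<Gamma> \<in> ?L" for A B \<Gamma>
    using that by (elim insertE emptyE) (auto simp: sep_form_def add_mset_eq_two add_mset_eq_three)
  have needs_c: "?c \<in># \<Delta>"
    if val: "valid_sequent (add_mset A \<Delta>)" and A: "A \<in> {Var p, Var q, NVar q}"
      and \<Delta>: "set_mset \<Delta> \<subseteq> {?a, ?b, Var p, ?c}" for A \<Delta>
  proof -
    \<comment> \<open>Makes \<open>p\<close> and \<open>A\<close> false. As \<open>p\<close> is
      false, \<open>?c\<close> is the only formula allowed in \<open>\<Delta>\<close> that can be
      true.\<close>
    let ?v = "\<lambda>x. A = NVar q \<and> x = q"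
    have "\<not> eval ?v A" using A assms(1) by auto
    then obtain C where "C \<in># \<Delta>" "eval ?v C"
      using val by (auto simp: valid_sequent_def)
    then show ?thesis using \<Delta> assms(1) by auto
  qed
  have "preserves ?I ax_rule"
    unfolding preserves_simps
    by (auto simp: sep_form_def valid_sequent_def add_mset_eq_two add_mset_eq_three)
  moreover have "preserves ?I with_rule"
    unfolding preserves_with
  proof (intro allI impI conjI)
    fix A B :: "'v form" and \<Gamma>
    assume prem: "?I (add_mset A \<Gamma>) \<and> ?I (add_mset B \<Gamma>)"
    then show "valid_sequent (add_mset (And A B) \<Gamma>)"
      by (fastforce simp: valid_sequent_def)
    \<comment> \<open>The listed premise is the one with \<open>Var p\<close>, or the one with the
      literal of \<open>q\<close> if \<open>Var p\<close> is already in the context.\<close>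
    have "add_mset A \<Gamma> \<in> ?L \<or> add_mset B \<Gamma> \<in> ?L" if "add_mset (And A B) \<Gamma> \<in> ?L"
      using And_in_L[OF that]
      by (elim disjE conjE insertE emptyE) (simp_all add: add_mset_commute)
    then show "add_mset (And A B) \<Gamma> \<notin> ?L"
      using prem by blast
  qed
  moreover have "preserves ?I tensor_rule"
    unfolding preserves_tensor
  proof (intro allI impI conjI)
    fix A B :: "'v form" and \<Delta> \<Sigma>
    assume prem: "?I (add_mset A \<Delta>) \<and> ?I (add_mset B \<Sigma>)"
    then show "valid_sequent (add_mset (And A B) (\<Delta> + \<Sigma>))"
      by (fastforce simp: valid_sequent_def)
    show "add_mset (And A B) (\<Delta> + \<Sigma>) \<notin> ?L"
    proof
      assume "add_mset (And A B) (\<Delta> + \<Sigma>) \<in> ?L"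
      then have AB: "{A, B} \<subseteq> {Var p, Var q, NVar q}"
        and ctx: "\<Delta> + \<Sigma> \<in> {{#?a, ?c#}, {#?b, ?c#}, {#Var p, ?c#}}"
        using And_in_L[of A B "\<Delta> + \<Sigma>"] by auto
      have "set_mset (\<Delta> + \<Sigma>) \<subseteq> {?a, ?b, Var p, ?c}"
        using ctx by fastforce
      then have "?c \<in># \<Delta>" "?c \<in># \<Sigma>"
        using needs_c[of A \<Delta>] needs_c[of B \<Sigma>] prem AB by auto
      \<comment> \<open>Each premise takes its own copy of \<open>?c\<close>, but a listed context
        has only one.\<close>
      then have "count (\<Delta> + \<Sigma>) ?c \<ge> 2"
        by (simp add: count_greater_zero_iff[symmetric] del: count_greater_zero_iff)
      moreover obtain C where "\<Delta> + \<Sigma> = {#C, ?c#}" "C \<noteq> ?c"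
        using ctx by auto
      then have "count (\<Delta> + \<Sigma>) ?c = 1"
        by (simp only:) simp
      ultimately show False by simp
    qed
  qed
  moreover have "preserves ?I plus_rule"
    unfolding preserves_plus
  proof (intro allI impI conjI)
    fix A B :: "'v form" and \<Gamma>
    assume prem: "?I (add_mset A \<Gamma>) \<or> ?I (add_mset B \<Gamma>)"
    then show "valid_sequent (add_mset (Or A B) \<Gamma>)"
      by (fastforce simp: valid_sequent_def)
    have inv: "\<not> valid_sequent \<Delta>" if "\<forall>C \<in># \<Delta>. \<not> eval v C" for \<Delta> :: "'v sequent" and v
      using that by (auto simp: valid_sequent_def)
    \<comment> \<open>The premises from which a listed disjunction could come by dropping a disjunct
      all have countermodels.\<close>
    have "\<not> valid_sequent {#Or ?a ?b#}"
      by (rule inv[of _ "\<lambda>x. False"]) simp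
    moreover have "\<not> valid_sequent {#?c#}" "\<not> valid_sequent {#?b, ?c#}"
      by (rule inv[of _ "\<lambda>x. True"], simp)+
    moreover have "\<not> valid_sequent {#?a, ?c#}"
      using assms(1) by (intro inv[of _ "\<lambda>x. x = p"]) simp
    ultimately have "\<not> valid_sequent (add_mset A \<Gamma>) \<and> \<not> valid_sequent (add_mset B \<Gamma>)"
      if "add_mset (Or A B) \<Gamma> \<in> ?L"
      using Or_in_L[OF that] by (elim disjE conjE) simp_all
    then show "add_mset (Or A B) \<Gamma> \<notin> ?L"
      using prem by blast
  qed
  moreover have "preserves ?I par_rule"
    unfolding preserves_par
  proof (intro allI impI conjI)
    fix A B :: "'v form" and \<Gamma>
    assume prem: "?I (add_mset A (add_mset B \<Gamma>))"
    then show "valid_sequent (add_mset (Or A B) \<Gamma>)"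
      by (auto simp: valid_sequent_def)
    have "add_mset A (add_mset B \<Gamma>) \<in> ?L" if "add_mset (Or A B) \<Gamma> \<in> ?L"
      using Or_in_L[OF that] by (elim disjE conjE) simp_all
    then show "add_mset (Or A B) \<Gamma> \<notin> ?L"
      using prem by blast
  qed
  ultimately show ?thesis
    using assms(2) by (intro incompleteI[of "sep_form p q" ?I] valid_sep_form) auto
qed

section \<open>Classification\<close>

text \<open>The axiom and the logical rules of \<open>Pp\<close> never conclude a sequent of
  positive variables only, and contraction cannot add \<open>Var p\<close> to such a
  sequent.\<close>

lemma weak_not_derivable_Pp:
  fixes p q :: 'v
  assumes "p \<noteq> q"
  shows "\<not> derivable_rule Pp (weak_rule :: 'v rule)"
proof
  let ?I = "\<lambda>\<Gamma>. \<not> (set_mset \<Gamma> \<subseteq> {Var p, Var q} \<and> Var p \<in># \<Gamma>)"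
  have pres: "preserves ?I r" if "r \<in> Pp" for r
    using that by (auto simp: Pp_def preserves_simps)
  assume "derivable_rule Pp (weak_rule :: 'v rule)"
  moreover have "([{#Var q#}], {#Var p, Var q#}) \<in> weak_rule"
    by (auto simp: weak_rule_def)
  ultimately have "derives Pp {{#Var q#}} {#Var p, Var q#}"
    by (fastforce simp: derivable_rule_def)
  from derives_invariant[of _ _ _ ?I, OF this pres] show False
    using assms by auto
qed

text \<open>A single variable is no conclusion of a rule of \<open>Np\<close>: weakening has a
  nonempty premise, so it concludes at least two formulas.\<close>

lemma contr_not_derivable_Np: "\<not> derivable_rule Np (contr_rule :: 'v rule)"
proof
  let ?p = "Var undefined :: 'v form"
  let ?I = "\<lambda>\<Gamma>. \<Gamma> \<noteq> {#?p#}"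
  have pres: "preserves ?I r" if "r \<in> Np" for r
    using that by (auto simp: Np_def preserves_simps)
  assume "derivable_rule Np (contr_rule :: 'v rule)"
  moreover have "([{#?p, ?p#}], {#?p#}) \<in> contr_rule"
    by (auto simp: contr_rule_def)
  ultimately have "derives Np {{#?p, ?p#}} {#?p#}"
    by (fastforce simp: derivable_rule_def)
  from derives_invariant[of _ _ _ ?I, OF this pres] show False
    by auto
qed

lemma equivalent_GS1p:
  assumes "S \<subseteq> {ax_rule, with_rule, tensor_rule, plus_rule, par_rule, weak_rule, contr_rule}"
    and "ax_rule \<in> S" "weak_rule \<in> S" "contr_rule \<in> S"
    and "with_rule \<in> S \<or> tensor_rule \<in> S" "plus_rule \<in> S \<or> par_rule \<in> S"
  shows "equivalent_systems S GS1p"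
  unfolding equivalent_systems_def
proof
  show "contains_system S GS1p"
    using assms(2-) by (auto simp: contains_system_def GS1p_def derivable_rule_member
        derivable_with derivable_plus)
  have "\<forall>r \<in> {ax_rule, with_rule, tensor_rule, plus_rule, par_rule, weak_rule, contr_rule}.
      derivable_rule GS1p r"
    by (simp add: GS1p_def derivable_rule_member derivable_tensor derivable_par)
  then show "contains_system GS1p S"
    using assms(1) unfolding contains_system_def by blast
qed

lemma equivalent_Np:
  assumes "S \<subseteq> {ax_rule, with_rule, tensor_rule, plus_rule, par_rule, weak_rule}"
    and "ax_rule \<in> S" "with_rule \<in> S" "par_rule \<in> S" "weak_rule \<in> S"
  shows "equivalent_systems S Np"
  unfolding equivalent_systems_def
proof
  show "contains_system S Np"
    using assms(2-) by (simp add: contains_system_def Np_def derivable_rule_member)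
  have "\<forall>r \<in> {ax_rule, with_rule, tensor_rule, plus_rule, par_rule, weak_rule}.
      derivable_rule Np r"
    by (simp add: Np_def derivable_rule_member derivable_tensor derivable_plus)
  then show "contains_system Np S"
    using assms(1) unfolding contains_system_def by blast
qed

lemma equivalent_Pp:
  assumes "S \<subseteq> {ax_rule, with_rule, tensor_rule, plus_rule, par_rule, contr_rule}"
    and "ax_rule \<in> S" "tensor_rule \<in> S" "plus_rule \<in> S" "contr_rule \<in> S"
  shows "equivalent_systems S Pp"
  unfolding equivalent_systems_def
proof
  show "contains_system S Pp"
    using assms(2-) by (simp add: contains_system_def Pp_def derivable_rule_member)
  have "\<forall>r \<in> {ax_rule, with_rule, tensor_rule, plus_rule, par_rule, contr_rule}.
      derivable_rule Pp r"
    by (simp add: Pp_def derivable_rule_member derivable_with derivable_par)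
  then show "contains_system Pp S"
    using assms(1) unfolding contains_system_def by blast
qed

text \<open>The presence of weakening and contraction decides the target system; each incompleteness
  lemma then forces one of its rules.\<close>

lemma complete_standard_cases:
  fixes p q :: 'v and S :: "'v system"
  assumes "p \<noteq> q" "standard_system S" "complete_system S"
  shows "equivalent_systems S GS1p \<or> equivalent_systems S Pp \<or> equivalent_systems S Np"
proof -
  have ax: "ax_rule \<in> S"
    and S: "S \<subseteq> {ax_rule, with_rule, tensor_rule, plus_rule, par_rule, weak_rule, contr_rule}"
    using assms(2) by (auto simp: standard_system_def)
  have conj: "with_rule \<in> S \<or> tensor_rule \<in> S"
    using incomplete_without_conj[of S] assms(3) S by blast
  have disj: "plus_rule \<in> S \<or> par_rule \<in> S"
    using incomplete_without_disj[of S] assms(3) S by blast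
  consider "weak_rule \<in> S" "contr_rule \<in> S" | "weak_rule \<in> S" "contr_rule \<notin> S" | "weak_rule \<notin> S"
    by blast
  then show ?thesis
  proof cases
    case 1
    then show ?thesis using equivalent_GS1p[OF S ax] conj disj by blast
  next
    case 2
    have "par_rule \<in> S"
      using incomplete_without_par_contr[of S] assms(3) S 2 by blast
    moreover have "with_rule \<in> S"
      using incomplete_without_with_contr[of S] assms(3) S 2 by blast
    ultimately have "equivalent_systems S Np"
      using S ax 2 by (intro equivalent_Np) blast+
    then show ?thesis by blast
  next
    case 3
    have "contr_rule \<in> S"
      using incomplete_without_weak_contr[OF assms(1), of S] assms(3) S 3 by blast
    moreover have "tensor_rule \<in> S"
      using incomplete_without_tensor_weak[OF assms(1), of S] assms(3) S 3 by blast
    moreover have "plus_rule \<in> S"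
      using incomplete_without_plus_weak[OF assms(1), of S] assms(3) S 3 by blast
    ultimately have "equivalent_systems S Pp"
      using S ax 3 by (intro equivalent_Pp) blast+
    then show ?thesis by blast
  qed
qed

lemma standard_systems: "standard_system GS1p" "standard_system Pp" "standard_system Np"
proof -
  have std: "standard_system (insert ax_rule R)"
    if "R \<subseteq> {with_rule, tensor_rule, plus_rule, par_rule, weak_rule, contr_rule}" for R
    using that by (auto simp: standard_system_def)
  show "standard_system GS1p" "standard_system Pp" "standard_system Np"
    unfolding GS1p_def Pp_def Np_def by (rule std; simp)+
qed

theorem theorem19:
  assumes "infinite (UNIV :: 'v set)"
  shows "standard_system (GS1p :: 'v system) \<and> complete_system (GS1p :: 'v system) \<and>
         standard_system (Pp :: 'v system) \<and> complete_system (Pp :: 'v system) \<and>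
         standard_system (Np :: 'v system) \<and> complete_system (Np :: 'v system) \<and>
         \<not> equivalent_systems (GS1p :: 'v system) Pp \<and>
         \<not> equivalent_systems (GS1p :: 'v system) Np \<and>
         \<not> equivalent_systems (Pp :: 'v system) Np \<and>
         (\<forall>S :: 'v system. standard_system S \<and> complete_system S \<longrightarrow>
            equivalent_systems S GS1p \<or> equivalent_systems S Pp \<or> equivalent_systems S Np)"
proof -
  obtain p q :: 'v where "p \<noteq> q"
    using assms finite_subset[of UNIV "{undefined :: 'v}"] by blast
  \<comment> \<open>Weakening separates \<open>Pp\<close> from the other two systems, contraction
    separates \<open>GS1p\<close> from \<open>Np\<close>.\<close>
  have "\<not> contains_system (Pp :: 'v system) GS1p" "\<not> contains_system (Pp :: 'v system) Np"
    using weak_not_derivable_Pp[OF \<open>p \<noteq> q\<close>] by (auto simp: contains_system_def GS1p_def Np_def)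
  moreover have "\<not> contains_system (Np :: 'v system) GS1p"
    using contr_not_derivable_Np[where 'v = 'v] by (auto simp: contains_system_def GS1p_def)
  ultimately show ?thesis
    using standard_systems complete_GS1p complete_Pp
      complete_Np complete_standard_cases[OF \<open>p \<noteq> q\<close>]
    unfolding equivalent_systems_def[of GS1p] equivalent_systems_def[of Pp Np] by blast
qed

end
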